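(* Let $q$ be a real parameter and $z$ a real number at which the Lambert-Tsallis function $W_q$ is defined. If $q$ is an algebraic and irrational number and $z \neq 0$ is algebraic, then $W_q(z)$ is transcendental; here $w = W_q(z)$ is a real solution of $w\, e_q^{w} = z$.
   Context: For a real parameter $q$ and real $z$, the Tsallis $q$-exponential $e_q^z = e_q(z) = \exp_q(z)$ is defined by: $e_q^z = e^z$ if $q = 1$; $e_q^z = [1+(1-q)z]^{1/(1-q)}$ if $q \neq 1$ and $1+(1-q)z \geq 0$; $e_q^z = 0$ if $q \neq 1$ and $1+(1-q)z < 0$. The Lambert-Tsallis function $W_q$ is defined as the solution of $W_q(z)\, e_q^{W_q(z)} = z$; that is, $W_q(z)$ denotes a real number $w$ with $w\, e_q^{w} = z$ (where there are several real branches, $W_q(z)$ may be the value on any of them). "Algebraic" and "transcendental" mean over $\mathbb{Q}$. *)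

theory Defs
  imports Complex_Main "HOL-Computational_Algebra.Polynomial"
begin

(* The q-exponential.  The only argument where powr deviates from the usual power is the pole
   1 + (1 - q) * z = 0 with q > 1, where 0 powr a = 0 for a < 0.  This can add a solution of
   w * tsallis_exp q w = z only for z = 0. *)
definition tsallis_exp :: "real \<Rightarrow> real \<Rightarrow> real" where
  "tsallis_exp q z =
     (if q = 1 then exp z
      else if 1 + (1 - q) * z \<ge> 0 then (1 + (1 - q) * z) powr (1 / (1 - q))
      else 0)"

(* The multivalued real function W_q: the set of its values at z over all real branches;
   it is empty when W_q is not defined at z. *)
definition lambert_tsallis :: "real \<Rightarrow> real \<Rightarrow> real set" where
  "lambert_tsallis q z = {w. w * tsallis_exp q w = z}"

abbreviation transcendental :: "real \<Rightarrow> bool" where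
  "transcendental x \<equiv> \<not> algebraic x"

end

theory Submission
  imports Defs
    "HOL-Complex_Analysis.Complex_Analysis"
    "HOL-Real_Asymp.Real_Asymp"
    "Jordan_Normal_Form.Char_Poly"
begin

text \<open>
  Write \<open>\<alpha> = 1 + (1 - q) * w\<close> and \<open>\<beta> = 1 / (1 - q)\<close>. Since \<open>z\<close> is nonzero, neither \<open>w\<close> nor the q-exponential of \<open>w\<close>
  vanishes; so \<open>\<alpha>\<close> is positive and different from 1, and \<open>\<alpha> powr \<beta> = z / w\<close>. If \<open>w\<close> were algebraic, then
  \<open>\<alpha>\<close>, the irrational number \<open>\<beta>\<close> and \<open>\<alpha> powr \<beta>\<close> would all be algebraic, against the theorem of Gelfond and
  Schneider.
  
  What has to be proved is therefore the Gelfond-Schneider theorem for \<open>\<alpha> > 0\<close> and real \<open>\<beta>\<close>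
  (\<open>gelfond_schneider_real\<close>), together with the closure of the real algebraic numbers under sums and
  products. The proof is Gelfond's, in the real setting. With \<open>l = ln \<alpha>\<close>, an auxiliary function
  \<open>F x = (\<Sum>i<T. \<Sum>t<N. p i t * x ^ i * exp (l * t * x))\<close> with small integers \<open>p i t\<close>, not all zero, is made to vanish
  at \<open>N ^ 4\<close> points \<open>s1 + s2 * \<beta>\<close> (Siegel's lemma, \<open>siegel_pigeonhole\<close>); this is possible because the values of
  \<open>F\<close> at these points are polynomials in \<open>\<alpha>\<close>, \<open>\<beta>\<close> and \<open>\<alpha> powr \<beta>\<close>. An exponential polynomial with real frequencies
  has fewer real zeros than coefficients (\<open>exponential_polynomial_zeros\<close>), so on a grid larger by a constant
  factor some value of \<open>F\<close> is nonzero. The many zeros force this value to be tiny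
  (\<open>schwarz_many_zeros\<close>), while a nonzero algebraic number of controlled size cannot be that small
  (\<open>acts_lower_bound\<close>). For large \<open>N\<close> the two estimates contradict each other.
  
  All arithmetic in number fields is replaced by integer matrices with a common real eigenvector: the
  predicate \<open>acts\<close> below. Algebraicity, conjugates and Liouville's inequality are read off from
  characteristic polynomials of such matrices.
\<close>

section \<open>Algebraic numbers as eigenvalues of integer matrices\<close>

text \<open>
  Integer matrices take the place of number fields. The predicate \<open>acts I e H y\<close> says that the real
  number \<open>y\<close> is realised on the vector \<open>e\<close>, indexed by the set \<open>I\<close>, by an integer matrix \<open>M\<close>: \<open>M e = y e\<close>.
  The natural number \<open>H\<close> bounds all absolute row sums of \<open>M\<close>. Row sums are submultiplicative, so \<open>H\<close>
  can be tracked through sums and products without further factors. The matrices are not required to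
  commute. If \<open>e\<close> has a nonzero entry then \<open>y\<close> is an eigenvalue of \<open>M\<close>, hence an algebraic integer
  whose conjugates are all bounded by \<open>H\<close>.
\<close>

definition acts :: "'i set \<Rightarrow> ('i \<Rightarrow> real) \<Rightarrow> nat \<Rightarrow> real \<Rightarrow> bool" where
  "acts I e H y \<longleftrightarrow>
     (\<exists>M :: 'i \<Rightarrow> 'i \<Rightarrow> int. \<forall>i\<in>I. (\<Sum>j\<in>I. of_int (M i j) * e j) = y * e i \<and>
        (\<Sum>j\<in>I. \<bar>M i j\<bar>) \<le> int H)"

lemma acts_mono: "acts I e H y \<Longrightarrow> H \<le> H' \<Longrightarrow> acts I e H' y"
  unfolding acts_def by (meson of_nat_mono order_trans)

lemma acts_of_int:
  assumes "finite I"
  shows "acts I e (nat \<bar>k\<bar>) (of_int k)"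
  unfolding acts_def
proof (intro exI ballI conjI)
  fix i assume i: "i \<in> I"
  have "(\<Sum>j\<in>I. real_of_int (if j = i then k else 0) * e j) = (\<Sum>j\<in>I. if j = i then of_int k * e j else 0)"
    by (intro sum.cong) auto
  thus "(\<Sum>j\<in>I. real_of_int (if j = i then k else 0) * e j) = of_int k * e i"
    using assms i by simp
  have "(\<Sum>j\<in>I. \<bar>if j = i then k else 0\<bar>) = (\<Sum>j\<in>I. if j = i then \<bar>k\<bar> else 0)"
    by (intro sum.cong) auto
  thus "(\<Sum>j\<in>I. \<bar>if j = i then k else 0\<bar>) \<le> int (nat \<bar>k\<bar>)"
    using assms i by simp
qed

lemma acts_of_nat: "finite I \<Longrightarrow> acts I e k (of_nat k)"
  using acts_of_int[of I e "int k"] by simp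

lemma acts_add:
  assumes "acts I e H x" "acts I e K y"
  shows "acts I e (H + K) (x + y)"
proof -
  from assms obtain M N where
    M: "\<And>i. i \<in> I \<Longrightarrow> (\<Sum>j\<in>I. of_int (M i j) * e j) = x * e i" "\<And>i. i \<in> I \<Longrightarrow> (\<Sum>j\<in>I. \<bar>M i j\<bar>) \<le> int H" and
    N: "\<And>i. i \<in> I \<Longrightarrow> (\<Sum>j\<in>I. of_int (N i j) * e j) = y * e i" "\<And>i. i \<in> I \<Longrightarrow> (\<Sum>j\<in>I. \<bar>N i j\<bar>) \<le> int K"
    unfolding acts_def by blast
  show ?thesis unfolding acts_def
  proof (intro exI ballI conjI)
    fix i assume i: "i \<in> I"
    show "(\<Sum>j\<in>I. real_of_int (M i j + N i j) * e j) = (x + y) * e i"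
      using M(1)[OF i] N(1)[OF i] by (simp add: distrib_right sum.distrib)
    have "(\<Sum>j\<in>I. \<bar>M i j + N i j\<bar>) \<le> (\<Sum>j\<in>I. \<bar>M i j\<bar> + \<bar>N i j\<bar>)"
      by (intro sum_mono abs_triangle_ineq)
    thus "(\<Sum>j\<in>I. \<bar>M i j + N i j\<bar>) \<le> int (H + K)"
      using M(2)[OF i] N(2)[OF i] by (simp add: sum.distrib)
  qed
qed

lemma acts_mult:
  assumes "acts I e H x" "acts I e K y"
  shows "acts I e (H * K) (x * y)"
proof -
  from assms obtain M N where
    M: "\<And>i. i \<in> I \<Longrightarrow> (\<Sum>j\<in>I. of_int (M i j) * e j) = x * e i" "\<And>i. i \<in> I \<Longrightarrow> (\<Sum>j\<in>I. \<bar>M i j\<bar>) \<le> int H" and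
    N: "\<And>i. i \<in> I \<Longrightarrow> (\<Sum>j\<in>I. of_int (N i j) * e j) = y * e i" "\<And>i. i \<in> I \<Longrightarrow> (\<Sum>j\<in>I. \<bar>N i j\<bar>) \<le> int K"
    unfolding acts_def by blast
  show ?thesis unfolding acts_def
  proof (intro exI ballI conjI)
    fix i assume i: "i \<in> I"
    have "(\<Sum>j\<in>I. real_of_int (\<Sum>k\<in>I. M i k * N k j) * e j)
        = (\<Sum>j\<in>I. \<Sum>k\<in>I. of_int (M i k) * (of_int (N k j) * e j))"
      by (simp add: sum_distrib_right mult.assoc)
    also have "\<dots> = (\<Sum>k\<in>I. of_int (M i k) * (\<Sum>j\<in>I. of_int (N k j) * e j))"
      by (subst sum.swap) (simp add: sum_distrib_left)
    also have "\<dots> = (\<Sum>k\<in>I. of_int (M i k) * (y * e k))"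
      by (intro sum.cong) (use N(1) in auto)
    also have "\<dots> = y * (\<Sum>k\<in>I. of_int (M i k) * e k)"
      by (simp add: sum_distrib_left mult_ac)
    also have "\<dots> = x * y * e i" using M(1)[OF i] by simp
    finally show "(\<Sum>j\<in>I. real_of_int (\<Sum>k\<in>I. M i k * N k j) * e j) = x * y * e i" .
    have "(\<Sum>j\<in>I. \<bar>\<Sum>k\<in>I. M i k * N k j\<bar>) \<le> (\<Sum>j\<in>I. \<Sum>k\<in>I. \<bar>M i k\<bar> * \<bar>N k j\<bar>)"
      by (intro sum_mono order_trans[OF sum_abs]) (simp add: abs_mult)
    also have "\<dots> = (\<Sum>k\<in>I. \<bar>M i k\<bar> * (\<Sum>j\<in>I. \<bar>N k j\<bar>))"
      by (subst sum.swap) (simp add: sum_distrib_left)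
    also have "\<dots> \<le> (\<Sum>k\<in>I. \<bar>M i k\<bar> * int K)"
      by (intro sum_mono mult_left_mono N(2)) auto
    also have "\<dots> = (\<Sum>k\<in>I. \<bar>M i k\<bar>) * int K" by (simp add: sum_distrib_right)
    also have "\<dots> \<le> int (H * K)" using M(2)[OF i] by (simp add: mult_right_mono)
    finally show "(\<Sum>j\<in>I. \<bar>\<Sum>k\<in>I. M i k * N k j\<bar>) \<le> int (H * K)" .
  qed
qed

lemma acts_power:
  assumes "finite I" "acts I e H x"
  shows "acts I e (H ^ k) (x ^ k)"
proof (induction k)
  case 0
  show ?case using acts_of_nat[OF assms(1), of e 1] by simp
next
  case (Suc k)
  thus ?case using acts_mult[OF assms(2) Suc.IH] by simp
qed

lemma acts_sum:
  assumes "finite I" "finite U" "\<And>u. u \<in> U \<Longrightarrow> acts I e (H u) (x u)"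
  shows "acts I e (\<Sum>u\<in>U. H u) (\<Sum>u\<in>U. x u)"
  using assms(2,3)
proof (induction U rule: finite_induct)
  case empty
  show ?case using acts_of_nat[OF assms(1), of e 0] by simp
next
  case (insert u U)
  thus ?case by (simp add: acts_add)
qed

text \<open>
  Two numbers realised on different vectors are realised together on the tensor product of the vectors,
  by the Kronecker product of one matrix with an identity matrix.
\<close>

lemma acts_tensor_left:
  fixes I :: "'a set" and J :: "'b set"
  assumes "finite J" "acts I e H x"
  shows "acts (I \<times> J) (\<lambda>(i, j). e i * f j) H x"
proof -
  from assms obtain M where
    M: "\<And>i. i \<in> I \<Longrightarrow> (\<Sum>j\<in>I. of_int (M i j) * e j) = x * e i" "\<And>i. i \<in> I \<Longrightarrow> (\<Sum>j\<in>I. \<bar>M i j\<bar>) \<le> int H"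
    unfolding acts_def by blast
  define N where "N p q = (if snd p = snd q then M (fst p) (fst q) else 0)" for p q :: "'a \<times> 'b"
  have delta: "(\<Sum>j\<in>J. if j0 = j then g j else 0) = g j0" if "j0 \<in> J" for j0 and g :: "'b \<Rightarrow> 'c::comm_monoid_add"
    using assms(1) that by simp
  show ?thesis unfolding acts_def
  proof (intro exI[of _ N] ballI conjI)
    fix p assume "p \<in> I \<times> J"
    then obtain i j where p: "p = (i, j)" "i \<in> I" "j \<in> J" by auto
    have "(\<Sum>q\<in>I \<times> J. real_of_int (N p q) * (case q of (i, j) \<Rightarrow> e i * f j))
        = (\<Sum>i'\<in>I. \<Sum>j'\<in>J. if j = j' then real_of_int (M i i') * (e i' * f j') else 0)"
      unfolding sum.cartesian_product by (intro sum.cong) (auto simp: N_def p)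
    also have "\<dots> = (\<Sum>i'\<in>I. of_int (M i i') * e i') * f j"
      by (simp add: delta p sum_distrib_right mult.assoc)
    finally show "(\<Sum>q\<in>I \<times> J. real_of_int (N p q) * (case q of (i, j) \<Rightarrow> e i * f j))
        = x * (case p of (i, j) \<Rightarrow> e i * f j)"
      using M(1) p by simp
    have "(\<Sum>q\<in>I \<times> J. \<bar>N p q\<bar>) = (\<Sum>i'\<in>I. \<Sum>j'\<in>J. if j = j' then \<bar>M i i'\<bar> else 0)"
      unfolding sum.cartesian_product by (intro sum.cong) (auto simp: N_def p)
    also have "\<dots> = (\<Sum>i'\<in>I. \<bar>M i i'\<bar>)"
      by (simp add: delta p)
    finally show "(\<Sum>q\<in>I \<times> J. \<bar>N p q\<bar>) \<le> int H" using M(2) p by simp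
  qed
qed

lemma acts_reindex:
  assumes "acts I e H x" "bij_betw b J I"
  shows "acts J (\<lambda>j. e (b j)) H x"
proof -
  from assms obtain M where
    M: "\<And>i. i \<in> I \<Longrightarrow> (\<Sum>j\<in>I. of_int (M i j) * e j) = x * e i" "\<And>i. i \<in> I \<Longrightarrow> (\<Sum>j\<in>I. \<bar>M i j\<bar>) \<le> int H"
    unfolding acts_def by blast
  have re: "(\<Sum>j\<in>J. g (b j)) = (\<Sum>i\<in>I. g i)" for g :: "'a \<Rightarrow> 'c::comm_monoid_add"
    using sum.reindex_bij_betw[OF assms(2)] .
  show ?thesis unfolding acts_def
  proof (intro exI[of _ "\<lambda>i j. M (b i) (b j)"] ballI conjI)
    fix i assume "i \<in> J"
    hence i: "b i \<in> I" using assms(2) by (auto simp: bij_betw_def)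
    show "(\<Sum>j\<in>J. real_of_int (M (b i) (b j)) * e (b j)) = x * e (b i)"
      using re[of "\<lambda>j. real_of_int (M (b i) j) * e j"] M(1)[OF i] by simp
    show "(\<Sum>j\<in>J. \<bar>M (b i) (b j)\<bar>) \<le> int H"
      using re[of "\<lambda>j. \<bar>M (b i) j\<bar>"] M(2)[OF i] by simp
  qed
qed

lemma acts_tensor_right:
  assumes "finite I" "acts J f H x"
  shows "acts (I \<times> J) (\<lambda>(i, j). e i * f j) H x"
proof -
  have "acts (J \<times> I) (\<lambda>(j, i). f j * e i) H x"
    by (rule acts_tensor_left[OF assms])
  moreover have "bij_betw prod.swap (I \<times> J) (J \<times> I)"
    by (auto simp: bij_betw_def inj_on_def)
  ultimately have "acts (I \<times> J) (\<lambda>p. case prod.swap p of (j, i) \<Rightarrow> f j * e i) H x"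
    by (rule acts_reindex)
  thus ?thesis
    by (simp add: case_prod_unfold mult.commute)
qed

text \<open>
  If \<open>D\<close> is the leading coefficient of an integer polynomial with root \<open>x\<close>, then \<open>D x\<close> is an algebraic
  integer, and a companion matrix realises it on the vector of its own powers.
\<close>

lemma algebraic_acts_powers:
  assumes "algebraic x"
  obtains n D H where "n > 0" "D > 0" "acts {..<n} (\<lambda>i. (of_nat D * x) ^ i) H (of_nat D * x)"
proof -
  obtain p :: "int poly" where p: "p \<noteq> 0" "poly (map_poly of_int p) x = 0"
    using assms by (rule algebraicE')
  obtain q :: "int poly" where q: "poly (map_poly of_int q) x = 0" "lead_coeff q > 0"
  proof (cases "lead_coeff p > 0")
    case True
    thus ?thesis using that p by blast
  next
    case False
    hence "lead_coeff (- p) > 0" using p(1) by (simp add: order_less_le)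
    moreover have "map_poly real_of_int (- p) = - map_poly real_of_int p"
      by (intro poly_eqI) (simp add: coeff_map_poly)
    hence "poly (map_poly of_int (- p)) x = 0"
      using p(2) by simp
    ultimately show ?thesis using that by blast
  qed
  define n where "n = degree q"
  define D where "D = nat (lead_coeff q)"
  define y where "y = of_nat D * x"
  have D: "D > 0" "real D = of_int (coeff q n)" using q(2) by (auto simp: D_def n_def)
  have sum0: "(\<Sum>i\<le>n. of_int (coeff q i) * x ^ i) = 0"
    using q(1) by (simp add: poly_altdef coeff_map_poly n_def degree_map_poly)
  have "n > 0"
  proof (rule ccontr)
    assume "\<not> n > 0"
    thus False using sum0 D by simp
  qed
  \<comment> \<open>multiplying the equation of \<open>x\<close> by \<open>D ^ (n - 1)\<close> gives a monic integer equation for \<open>y\<close>\<close>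
  define c where "c i = - coeff q i * int D ^ (n - 1 - i)" for i
  have yn: "y ^ n = (\<Sum>i<n. of_int (c i) * y ^ i)"
  proof -
    have "real D ^ (n - 1) * (\<Sum>i\<le>n. of_int (coeff q i) * x ^ i) = 0" by (simp add: sum0)
    hence "real D ^ (n - 1) * (of_int (coeff q n) * x ^ n)
         + (\<Sum>i<n. real D ^ (n - 1) * (of_int (coeff q i) * x ^ i)) = 0"
      by (simp add: sum_distrib_left lessThan_Suc_atMost[symmetric] algebra_simps)
    moreover have "real D ^ (n - 1) * (of_int (coeff q n) * x ^ n) = y ^ n"
      using \<open>n > 0\<close> unfolding D(2)[symmetric] y_def power_mult_distrib
      by (cases n) (simp_all add: mult_ac)
    moreover have "(\<Sum>i<n. real D ^ (n - 1) * (of_int (coeff q i) * x ^ i)) = - (\<Sum>i<n. of_int (c i) * y ^ i)"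
      unfolding sum_negf[symmetric]
    proof (intro sum.cong refl)
      fix i assume "i \<in> {..<n}"
      hence "real D ^ (n - 1) = real D ^ (n - 1 - i) * real D ^ i"
        by (subst power_add[symmetric]) auto
      thus "real D ^ (n - 1) * (of_int (coeff q i) * x ^ i) = - (of_int (c i) * y ^ i)"
        by (simp add: c_def y_def power_mult_distrib)
    qed
    ultimately show ?thesis by linarith
  qed
  define M where "M i j = (if i = n - 1 then c j else if j = Suc i then 1 else 0)" for i j
  define H where "H = nat (\<Sum>i<n. \<Sum>j<n. \<bar>M i j\<bar>)"
  have "acts {..<n} (\<lambda>i. y ^ i) H y"
    unfolding acts_def
  proof (intro exI[of _ M] ballI conjI)
    fix i assume i: "i \<in> {..<n}"
    show "(\<Sum>j<n. real_of_int (M i j) * y ^ j) = y * y ^ i"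
    proof (cases "i = n - 1")
      case True
      thus ?thesis using yn \<open>n > 0\<close> by (simp add: M_def flip: power_Suc)
    next
      case False
      hence "(\<Sum>j<n. real_of_int (M i j) * y ^ j) = (\<Sum>j<n. if j = Suc i then y ^ j else 0)"
        by (intro sum.cong) (auto simp: M_def)
      also have "\<dots> = y ^ Suc i" using i False by auto
      finally show ?thesis by simp
    qed
    have "(\<Sum>j<n. \<bar>M i j\<bar>) \<le> (\<Sum>i<n. \<Sum>j<n. \<bar>M i j\<bar>)"
      using i by (intro member_le_sum) (auto intro: sum_nonneg)
    thus "(\<Sum>j<n. \<bar>M i j\<bar>) \<le> int H" by (simp add: H_def)
  qed
  thus ?thesis using that \<open>n > 0\<close> D(1) unfolding y_def by blast
qed

text \<open>
  Up to sign, the product of the nonzero roots of a monic integer polynomial is its lowest nonvanishing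
  coefficient, a nonzero integer.
\<close>

lemma norm_prod_nonzero_roots_ge_1:
  fixes p :: "int poly" and as :: "complex list"
  assumes "map_poly of_int p = (\<Prod>a\<leftarrow>as. [:- a, 1:])"
  shows "1 \<le> (\<Prod>a\<leftarrow>filter (\<lambda>a. a \<noteq> 0) as. norm a)"
proof -
  define g where "g = (\<Prod>a\<leftarrow>filter (\<lambda>a. a \<noteq> 0) as. [:- a, 1:])"
  have "\<exists>k. (\<Prod>a\<leftarrow>bs. [:- a, 1:]) = monom 1 k * (\<Prod>a\<leftarrow>filter (\<lambda>a. a \<noteq> 0) bs. [:- a, 1:])"
    for bs :: "complex list"
  proof (induction bs)
    case Nil
    show ?case by (rule exI[of _ 0]) simp
  next
    case (Cons b bs)
    then obtain k where k: "(\<Prod>a\<leftarrow>bs. [:- a, 1:]) = monom 1 k * (\<Prod>a\<leftarrow>filter (\<lambda>a. a \<noteq> 0) bs. [:- a, 1:])"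
      by blast
    show ?case
    proof (cases "b = 0")
      case True
      thus ?thesis using k by (intro exI[of _ "Suc k"]) (simp add: monom_Suc)
    next
      case False
      thus ?thesis using k by (intro exI[of _ k]) (simp add: mult_ac)
    qed
  qed
  then obtain k where "map_poly of_int p = monom 1 k * g"
    unfolding assms g_def by blast
  hence "coeff (map_poly of_int p) k = coeff g 0"
    by (simp add: coeff_monom_mult)
  hence eq: "of_int (coeff p k) = coeff g 0" by (simp add: coeff_map_poly)
  have norm: "norm (coeff (\<Prod>a\<leftarrow>bs. [:- a, 1:]) 0) = (\<Prod>a\<leftarrow>bs. norm a)" for bs :: "complex list"
    by (induction bs) (auto simp: coeff_mult norm_mult)
  have "norm (coeff g 0) \<noteq> 0"
    unfolding g_def norm by (auto simp: prod_list_zero_iff)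
  hence "coeff p k \<noteq> 0" using eq by auto
  hence "1 \<le> \<bar>coeff p k\<bar>" by linarith
  hence "1 \<le> norm (of_int (coeff p k) :: complex)" by simp
  thus ?thesis unfolding eq g_def norm .
qed

text \<open>
  The polynomial \<open>p\<close> is the characteristic polynomial of a matrix that realises \<open>y\<close>, and \<open>as\<close> lists its complex
  roots with multiplicity.
\<close>

lemma acts_char_poly:
  assumes I: "finite I" and i0: "i0 \<in> I" "e i0 \<noteq> 0" and acts: "acts I e H y"
  obtains p :: "int poly" and as :: "complex list" where "lead_coeff p = 1"
    "map_poly of_int p = (\<Prod>a\<leftarrow>as. [:- a, 1:])" "length as = card I"
    "complex_of_real y \<in> set as" "\<And>a. a \<in> set as \<Longrightarrow> norm a \<le> real H"
proof -
  define n where "n = card I"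
  obtain b where b: "bij_betw b {..<n} I"
    using ex_bij_betw_nat_finite[OF I] by (auto simp: n_def atLeast0LessThan)
  define f where "f i = e (b i)" for i
  from i0 b obtain k0 where k0: "k0 < n" "f k0 \<noteq> 0"
    unfolding f_def by (metis bij_betw_iff_bijections lessThan_iff)
  have "acts {..<n} f H y" unfolding f_def by (rule acts_reindex[OF acts b])
  then obtain M where
    M: "\<And>i. i < n \<Longrightarrow> (\<Sum>j<n. of_int (M i j) * f j) = y * f i"
       "\<And>i. i < n \<Longrightarrow> (\<Sum>j<n. \<bar>M i j\<bar>) \<le> int H"
    unfolding acts_def by auto
  define A where "A = mat n n (\<lambda>(i, j). M i j)"
  define Ac :: "complex mat" where "Ac = map_mat of_int A"
  have A: "A \<in> carrier_mat n n" "Ac \<in> carrier_mat n n" by (auto simp: A_def Ac_def)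
  define p where "p = char_poly A"
  have p: "char_poly Ac = map_poly of_int p"
    unfolding p_def Ac_def by (rule of_int_hom.char_poly_hom[OF A(1)])
  obtain as where as: "char_poly Ac = (\<Prod>a\<leftarrow>as. [:- a, 1:])" "length as = n"
    using char_poly_factorized[OF A(2)] by blast
  have root: "eigenvalue Ac a \<longleftrightarrow> a \<in> set as" for a
    unfolding eigenvalue_root_char_poly[OF A(2)] as(1) by (auto simp: poly_prod_list prod_list_zero_iff o_def)
  define v where "v = vec n (\<lambda>i. complex_of_real (f i))"
  have "eigenvector Ac v (of_real y)"
    unfolding eigenvector_def
  proof (intro conjI)
    show "v \<in> carrier_vec (dim_row Ac)" using A by (simp add: v_def)
    show "v \<noteq> 0\<^sub>v (dim_row Ac)"
    proof
      assume "v = 0\<^sub>v (dim_row Ac)"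
      hence "v $ k0 = 0\<^sub>v (dim_row Ac) $ k0" by simp
      thus False using k0 A by (simp add: v_def)
    qed
    show "Ac *\<^sub>v v = complex_of_real y \<cdot>\<^sub>v v"
    proof (rule eq_vecI)
      fix i assume "i < dim_vec (complex_of_real y \<cdot>\<^sub>v v)"
      hence i: "i < n" by (simp add: v_def)
      have "(Ac *\<^sub>v v) $ i = (\<Sum>j<n. complex_of_real (of_int (M i j) * f j))"
        using i by (simp add: Ac_def A_def v_def scalar_prod_def atLeast0LessThan)
      also have "\<dots> = complex_of_real (y * f i)"
        unfolding of_real_sum[symmetric] using M(1)[OF i] by simp
      finally show "(Ac *\<^sub>v v) $ i = (complex_of_real y \<cdot>\<^sub>v v) $ i"
        using i by (simp add: v_def)
    qed (use A in \<open>auto simp: v_def\<close>)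
  qed
  hence y: "complex_of_real y \<in> set as"
    using root unfolding eigenvalue_def by blast
  have bound: "norm a \<le> real H" if "a \<in> set as" for a
  proof -
    have ev: "eigenvalue Ac a" using that root by blast
    obtain w where w: "w \<in> carrier_vec n" "w \<noteq> 0\<^sub>v n" "Ac *\<^sub>v w = a \<cdot>\<^sub>v w"
      using ev A(2)
      unfolding eigenvalue_def eigenvector_def carrier_matD(1)[OF A(2)] by blast
    have "n > 0" using k0 by simp
    \<comment> \<open>the row of the largest entry of an eigenvector bounds the eigenvalue by that row sum\<close>
    define \<mu> where "\<mu> = Max ((\<lambda>i. norm (w $ i)) ` {..<n})"
    have "\<mu> \<in> (\<lambda>i. norm (w $ i)) ` {..<n}"
      unfolding \<mu>_def using \<open>n > 0\<close> by (intro Max_in) auto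
    then obtain i where i: "i < n" "norm (w $ i) = \<mu>" by auto
    have le: "norm (w $ j) \<le> \<mu>" if "j < n" for j
      unfolding \<mu>_def using that by (intro Max_ge) auto
    obtain j where j: "j < n" "w $ j \<noteq> 0"
      using w(1,2) by (metis carrier_vecD eq_vecI index_zero_vec(1) index_zero_vec(2))
    have "\<mu> > 0" using le[OF j(1)] j(2) by (meson less_le_trans zero_less_norm_iff)
    have "a * w $ i = (Ac *\<^sub>v w) $ i" using w i by simp
    also have "\<dots> = (\<Sum>j<n. of_int (M i j) * w $ j)"
      using i w(1) by (simp add: Ac_def A_def scalar_prod_def atLeast0LessThan)
    finally have "norm a * \<mu> \<le> (\<Sum>j<n. norm (of_int (M i j) * w $ j))"
      by (metis i(2) norm_mult norm_sum)
    also have "\<dots> \<le> (\<Sum>j<n. of_int \<bar>M i j\<bar> * \<mu>)"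
      by (intro sum_mono) (auto simp: norm_mult intro!: mult_left_mono le)
    also have "\<dots> = of_int (\<Sum>j<n. \<bar>M i j\<bar>) * \<mu>" by (simp add: sum_distrib_right)
    also have "\<dots> \<le> of_int (int H) * \<mu>"
      using \<open>\<mu> > 0\<close> M(2)[OF i(1)] by (intro mult_right_mono of_int_le_iff[THEN iffD2]) auto
    finally show ?thesis using \<open>\<mu> > 0\<close> by simp
  qed
  show ?thesis
  proof (rule that[of p as])
    show "lead_coeff p = 1" using degree_monic_char_poly[OF A(1)] by (simp add: p_def)
    show "map_poly of_int p = (\<Prod>a\<leftarrow>as. [:- a, 1:])" using p as(1) by simp
  qed (use as(2) n_def y bound in auto)
qed

lemma acts_imp_algebraic:
  assumes "finite I" "i0 \<in> I" "e i0 \<noteq> 0" "acts I e H y"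
  shows "algebraic y"
proof -
  obtain p :: "int poly" and as where p: "lead_coeff p = 1"
    "map_poly of_int p = (\<Prod>a\<leftarrow>as. [:- a, 1:])" "complex_of_real y \<in> set as"
    using acts_char_poly[OF assms] by metis
  have "poly (map_poly of_int p) (complex_of_real y) = 0"
    unfolding p(2) using p(3) by (auto simp: poly_prod_list prod_list_zero_iff o_def)
  moreover have "poly (map_poly of_int p) (complex_of_real y) = of_real (poly (map_poly of_int p) y)"
    by (simp add: poly_altdef degree_map_poly coeff_map_poly)
  ultimately have "poly (map_poly of_int p) y = 0" by simp
  moreover have "p \<noteq> 0" using p(1) by auto
  hence "map_poly of_int p \<noteq> (0 :: real poly)" by simp
  moreover have "coeff (map_poly of_int p) i \<in> (\<int> :: real set)" for i
    by (simp add: coeff_map_poly)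
  ultimately show ?thesis by (intro algebraicI[of "map_poly of_int p"])
qed

text \<open>
  Liouville's inequality: the nonzero eigenvalues of a matrix that realises \<open>y\<close> have a product of modulus at
  least 1, and there are at most \<open>card I\<close> of them, each of modulus at most \<open>H\<close>; one of them is \<open>y\<close>. A nonzero \<open>y\<close> is therefore not too small.
\<close>

lemma acts_lower_bound:
  assumes "finite I" "i0 \<in> I" "e i0 \<noteq> 0" "acts I e H y" "y \<noteq> 0"
  shows "1 \<le> \<bar>y\<bar> * real H ^ (card I)"
proof -
  obtain p :: "int poly" and as where p: "lead_coeff p = 1"
    "map_poly of_int p = (\<Prod>a\<leftarrow>as. [:- a, 1:])" "length as = card I"
    "complex_of_real y \<in> set as" "\<And>a. a \<in> set as \<Longrightarrow> norm a \<le> real H"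
    using acts_char_poly[OF assms(1-4)] by metis
  define bs where "bs = filter (\<lambda>a. a \<noteq> 0) as"
  have ge1: "1 \<le> (\<Prod>a\<leftarrow>bs. norm a)"
    unfolding bs_def by (rule norm_prod_nonzero_roots_ge_1[OF p(2)])
  have y: "complex_of_real y \<in> set bs" using p(4) assms(5) by (simp add: bs_def)
  have bs: "norm a \<le> real H" if "a \<in> set bs" for a using p(5) that by (auto simp: bs_def)
  have "\<bar>y\<bar> \<le> real H" using bs[OF y] by simp
  hence "real H > 0" using assms(5) by linarith
  hence H: "real H \<ge> 1" by simp
  have prod_le: "(\<Prod>a\<leftarrow>cs. norm a) \<le> real H ^ length cs"
    if "\<And>a. a \<in> set cs \<Longrightarrow> norm a \<le> real H" for cs :: "complex list"
    using that by (induction cs) (auto intro!: mult_mono prod_list_nonneg)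
  have "(\<Prod>a\<leftarrow>bs. norm a) = \<bar>y\<bar> * (\<Prod>a\<leftarrow>remove1 (of_real y) bs. norm a)"
    using y by (induction bs) auto
  also have "\<dots> \<le> \<bar>y\<bar> * real H ^ length (remove1 (complex_of_real y) bs)"
    by (intro mult_left_mono prod_le bs) (auto dest: notin_set_remove1 set_remove1_subset[THEN subsetD])
  also have "\<dots> \<le> \<bar>y\<bar> * real H ^ card I"
  proof (intro mult_left_mono power_increasing)
    have "length bs \<le> length as" by (simp add: bs_def)
    thus "length (remove1 (complex_of_real y) bs) \<le> card I"
      using p(3) by (auto simp: length_remove1)
  qed (use H in auto)
  finally show ?thesis using ge1 by linarith
qed

lemma algebraic_of_nat_mult_cancel:
  assumes "algebraic (of_nat k * x)" "k > 0"
  shows "algebraic (x::real)"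
proof -
  obtain p :: "int poly" where p: "p \<noteq> 0" "poly (map_poly of_int p) (of_nat k * x) = 0"
    using assms(1) by (rule algebraicE')
  have "map_poly of_int p \<noteq> (0 :: real poly)" using p(1) by simp
  show ?thesis
  proof (rule algebraicI)
    show "coeff (map_poly of_int (pcompose p [:0, int k:])) i \<in> (\<int> :: real set)" for i
      by (simp add: coeff_map_poly)
    have "pcompose p [:0, int k:] \<noteq> 0" using p(1) assms(2) by (simp add: pcompose_eq_0_iff)
    thus "map_poly of_int (pcompose p [:0, int k:]) \<noteq> (0 :: real poly)"
      by simp
    show "poly (map_poly of_int (pcompose p [:0, int k:])) x = 0"
    proof -
      have "map_poly real_of_int [:0, int k:] = [:0, real k:]"
        by (rule poly_eqI) (simp add: coeff_map_poly coeff_pCons split: nat.split)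
      thus ?thesis
        using p(2) by (simp only: of_int_hom.map_poly_pcompose poly_pcompose) (simp add: mult.commute)
    qed
  qed
qed

lemma algebraic_common_acts:
  assumes "algebraic x" "algebraic y"
  obtains I :: "(nat \<times> nat) set" and e i0 D H where "finite I" "i0 \<in> I" "e i0 \<noteq> 0"
    "D > 0" "acts I e H (of_nat D * x)" "acts I e H (of_nat D * y)"
proof -
  obtain n D H where x: "n > 0" "D > 0" "acts {..<n} (\<lambda>i. (of_nat D * x) ^ i) H (of_nat D * x)"
    using algebraic_acts_powers[OF assms(1)] by blast
  obtain m E K where y: "m > 0" "E > 0" "acts {..<m} (\<lambda>i. (of_nat E * y) ^ i) K (of_nat E * y)"
    using algebraic_acts_powers[OF assms(2)] by blast
  define I where "I = {..<n} \<times> {..<m}"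
  define e where "e = (\<lambda>(i, j). (real D * x) ^ i * (real E * y) ^ j)"
  define L where "L = E * H + D * K"
  have fin: "finite I" by (simp add: I_def)
  have "acts I e (E * H) (of_nat E * (of_nat D * x))"
    unfolding I_def e_def by (intro acts_mult acts_of_nat acts_tensor_left x) auto
  from acts_mono[OF this, of L] have 1: "acts I e L (of_nat (D * E) * x)"
    by (simp add: L_def mult_ac)
  have "acts I e (D * K) (of_nat D * (of_nat E * y))"
    unfolding I_def e_def by (intro acts_mult acts_of_nat acts_tensor_right y) auto
  from acts_mono[OF this, of L] have 2: "acts I e L (of_nat (D * E) * y)"
    by (simp add: L_def mult_ac)
  show ?thesis
    by (rule that[OF fin _ _ _ 1 2, of "(0, 0)"]) (use x y in \<open>auto simp: I_def e_def\<close>)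
qed

lemma algebraic_common_acts3:
  assumes "algebraic x" "algebraic y" "algebraic z"
  obtains I :: "((nat \<times> nat) \<times> nat) set" and e i0 D h where "finite I" "i0 \<in> I" "e i0 \<noteq> 0"
    "D > 0" "D \<le> h" "2 \<le> h" "acts I e h (of_nat D * x)" "acts I e h (of_nat D * y)" "acts I e h (of_nat D * z)"
proof -
  obtain I :: "(nat \<times> nat) set" and e i0 D H where 1: "finite I" "i0 \<in> I" "e i0 \<noteq> 0"
    "D > 0" "acts I e H (of_nat D * x)" "acts I e H (of_nat D * y)"
    by (rule algebraic_common_acts[OF assms(1,2)])
  obtain m E K where 2: "m > 0" "E > 0" "acts {..<m} (\<lambda>i. (of_nat E * z) ^ i) K (of_nat E * z)"
    by (rule algebraic_acts_powers[OF assms(3)])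
  define J where "J = I \<times> {..<m}"
  define f where "f = (\<lambda>(i, j). e i * (real E * z) ^ j)"
  define h where "h = E * H + D * K + D * E + 2"
  have fin: "finite J" using 1 by (simp add: J_def)
  have left: "acts J f h (of_nat (D * E) * w)" if "acts I e H (of_nat D * w)" for w
  proof -
    have "acts J f (E * H) (of_nat E * (of_nat D * w))"
      unfolding J_def f_def using 1 that by (intro acts_mult acts_of_nat acts_tensor_left) auto
    from acts_mono[OF this, of h] show ?thesis by (simp add: h_def mult_ac)
  qed
  have "acts J f (D * K) (of_nat D * (of_nat E * z))"
    unfolding J_def f_def using 1 by (intro acts_mult acts_of_nat acts_tensor_right 2(3)) auto
  from acts_mono[OF this, of h] have right: "acts J f h (of_nat (D * E) * z)"
    by (simp add: h_def mult_ac)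
  show ?thesis
    by (rule that[OF fin _ _ _ _ _ left[OF 1(5)] left[OF 1(6)] right, of "(i0, 0)"])
       (use 1 2 in \<open>auto simp: J_def f_def h_def\<close>)
qed

lemma algebraic_add:
  assumes "algebraic x" "algebraic (y::real)"
  shows "algebraic (x + y)"
proof -
  obtain I :: "(nat \<times> nat) set" and e i0 D H where *: "finite I" "i0 \<in> I" "e i0 \<noteq> 0"
    "D > 0" "acts I e H (of_nat D * x)" "acts I e H (of_nat D * y)"
    by (rule algebraic_common_acts[OF assms])
  have "algebraic (of_nat D * x + of_nat D * y)"
    by (rule acts_imp_algebraic[OF *(1-3) acts_add[OF *(5,6)]])
  thus ?thesis using algebraic_of_nat_mult_cancel[OF _ *(4)] by (simp add: distrib_left)
qed

lemma algebraic_mult: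
  assumes "algebraic x" "algebraic (y::real)"
  shows "algebraic (x * y)"
proof -
  obtain I :: "(nat \<times> nat) set" and e i0 D H where *: "finite I" "i0 \<in> I" "e i0 \<noteq> 0"
    "D > 0" "acts I e H (of_nat D * x)" "acts I e H (of_nat D * y)"
    by (rule algebraic_common_acts[OF assms])
  have "algebraic ((of_nat D * x) * (of_nat D * y))"
    by (rule acts_imp_algebraic[OF *(1-3) acts_mult[OF *(5,6)]])
  thus ?thesis using algebraic_of_nat_mult_cancel[of "D * D" "x * y"] *(4) by (simp add: mult_ac)
qed

section \<open>Siegel's lemma\<close>

text \<open>
  A homogeneous integer linear system with twice as many unknowns as equations has a small nonzero
  integer solution.
\<close>

lemma siegel_pigeonhole:
  fixes a :: "'u \<Rightarrow> 'v \<Rightarrow> int" and A :: nat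
  assumes fin: "finite U" "finite V"
    and card: "card U = 2 * card V" "card V > 0"
    and A: "A \<ge> 1" "\<And>u v. u \<in> U \<Longrightarrow> v \<in> V \<Longrightarrow> \<bar>a u v\<bar> \<le> int A"
  obtains p :: "'u \<Rightarrow> int"
  where "\<exists>u\<in>U. p u \<noteq> 0" "\<And>u. u \<in> U \<Longrightarrow> \<bar>p u\<bar> \<le> 2 * int (card U) * int A"
    "\<And>v. v \<in> V \<Longrightarrow> (\<Sum>u\<in>U. p u * a u v) = 0"
proof -
  define m where "m = card U"
  \<comment> \<open>with this \<open>B\<close> there are \<open>(B + 1) ^ (2 * card V)\<close> vectors with entries between 0 and \<open>B\<close>,
    but at most \<open>(B ^ 2 + 1) ^ card V\<close> possible values of the system on them\<close>
  define B :: nat where "B = 2 * m * A"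
  define X where "X = U \<rightarrow>\<^sub>E {0..int B}"
  define C where "C = int (m * A * B)"
  define Y where "Y = V \<rightarrow>\<^sub>E {- C..C}"
  define \<phi> where "\<phi> x = restrict (\<lambda>v. \<Sum>u\<in>U. x u * a u v) V" for x :: "'u \<Rightarrow> int"
  have cX: "card X = (B + 1) ^ card U"
    unfolding X_def by (subst card_PiE) (use fin in \<open>auto simp: nat_add_distrib\<close>)
  have C_nonneg: "C \<ge> 0" by (simp add: C_def)
  have cI: "card {- C..C} = 2 * (m * A * B) + 1"
  proof -
    have "card {- C..C} = nat (int (2 * (m * A * B) + 1))"
      by (simp add: C_def algebra_simps)
    thus ?thesis by (simp only: nat_int)
  qed
  have "card Y = (2 * (m * A * B) + 1) ^ card V"
    unfolding Y_def by (subst card_PiE) (use fin cI in auto)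
  also have "2 * (m * A * B) = B ^ 2"
    by (simp add: B_def power2_eq_square)
  finally have cY: "card Y = (B ^ 2 + 1) ^ card V" .
  have "B > 0" using card A by (simp add: B_def m_def)
  have "(B ^ 2 + 1) ^ card V < ((B + 1) ^ 2) ^ card V"
    using \<open>B > 0\<close> card by (intro power_strict_mono) (auto simp: power2_eq_square)
  hence less: "card Y < card X"
    unfolding cX cY card power_mult .
  have finY: "finite Y"
    unfolding Y_def using fin by (intro finite_PiE) auto
  have "\<phi> ` X \<subseteq> Y"
  proof (intro image_subsetI)
    fix x assume x: "x \<in> X"
    have "\<bar>\<Sum>u\<in>U. x u * a u v\<bar> \<le> C" if v: "v \<in> V" for v
    proof -
      have "\<bar>\<Sum>u\<in>U. x u * a u v\<bar> \<le> (\<Sum>u\<in>U. \<bar>x u * a u v\<bar>)" by (rule sum_abs)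
      also have "\<dots> \<le> (\<Sum>u\<in>U. int B * int A)"
      proof (rule sum_mono)
        fix u assume u: "u \<in> U"
        have "\<bar>x u\<bar> \<le> int B" using x u by (auto simp: X_def PiE_def Pi_def)
        thus "\<bar>x u * a u v\<bar> \<le> int B * int A"
          using A(2)[OF u v] by (simp add: abs_mult mult_mono)
      qed
      also have "\<dots> = C" by (simp add: C_def m_def mult_ac)
      finally show ?thesis .
    qed
    thus "\<phi> x \<in> Y" by (auto simp: \<phi>_def Y_def abs_le_iff) (metis minus_le_iff)
  qed
  hence "card (\<phi> ` X) < card X"
    using card_mono[OF finY] less by (meson le_less_trans)
  hence "\<not> inj_on \<phi> X" by (rule pigeonhole)
  then obtain x y where xy: "x \<in> X" "y \<in> X" "x \<noteq> y" "\<phi> x = \<phi> y"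
    unfolding inj_on_def by blast
  show ?thesis
  proof (rule that[of "\<lambda>u. x u - y u"])
    show "\<exists>u\<in>U. x u - y u \<noteq> 0"
      using xy(1-3) unfolding X_def by (metis PiE_ext eq_iff_diff_eq_0)
    show "\<bar>x u - y u\<bar> \<le> 2 * int (card U) * int A" if "u \<in> U" for u
    proof -
      have "x u \<in> {0..int B}" "y u \<in> {0..int B}" using that xy(1,2) by (auto simp: X_def)
      thus ?thesis by (auto simp: B_def m_def)
    qed
    show "(\<Sum>u\<in>U. (x u - y u) * a u v) = 0" if "v \<in> V" for v
    proof -
      have "\<phi> x v = \<phi> y v" using xy by simp
      thus ?thesis using that by (simp add: \<phi>_def left_diff_distrib sum_subtractf)
    qed
  qed
qed

section \<open>Real zeros of exponential polynomials\<close>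

lemma rolle_card:
  fixes f f' :: "real \<Rightarrow> real"
  assumes der: "\<And>x. (f has_real_derivative f' x) (at x)"
    and "finite Z" "\<And>z. z \<in> Z \<Longrightarrow> f z = 0"
  shows "\<exists>Z'. finite Z' \<and> card Z \<le> card Z' + 1 \<and> (\<forall>z\<in>Z'. f' z = 0)"
proof -
  have "\<exists>Z'. finite Z' \<and> card Z \<le> card Z' + 1 \<and> (\<forall>z\<in>Z'. f' z = 0 \<and> (\<exists>b\<in>Z. z < b))"
    using assms(2,3)
  proof (induction Z rule: finite_linorder_max_induct)
    case empty
    show ?case by (rule exI[of _ "{}"]) auto
  next
    case (insert b A)
    then obtain Z' where Z': "finite Z'" "card A \<le> card Z' + 1"
      "\<And>z. z \<in> Z' \<Longrightarrow> f' z = 0" "\<And>z. z \<in> Z' \<Longrightarrow> \<exists>b\<in>A. z < b" by auto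
    show ?case
    proof (cases "A = {}")
      case True
      thus ?thesis by (intro exI[of _ "{}"]) auto
    next
      case False
      define a where "a = Max A"
      have a: "a \<in> A" "\<And>x. x \<in> A \<Longrightarrow> x \<le> a"
        using False insert.hyps by (auto simp: a_def)
      have "a < b" using a insert.hyps by auto
      moreover have "f a = f b" using a insert.prems by auto
      moreover have "continuous_on {a..b} f"
        by (rule DERIV_continuous_on[OF has_field_derivative_at_within[OF der]])
      ultimately obtain z where z: "a < z" "z < b" "(*) (f' z) = (\<lambda>v. 0)"
        using Rolle_deriv[of a b f "\<lambda>x. (*) (f' x)"] der
        unfolding has_field_derivative_def by blast
      have "f' z = 0" using fun_cong[OF z(3), of 1] by simp
      moreover have "z \<notin> Z'" using Z'(4) a(2) z(1) by force
      moreover have "b \<notin> A" using insert.hyps by auto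
      ultimately show ?thesis
        using Z' z(2) insert.hyps
        by (intro exI[of _ "insert z Z'"]) auto
    qed
  qed
  thus ?thesis by blast
qed

text \<open>
  A real exponential polynomial with distinct real frequencies has fewer real zeros than coefficients.
  Dividing by one of the exponentials and differentiating lowers the number of coefficients by one, and
  by Rolle's theorem it loses at most one zero.
\<close>

lemma exponential_polynomial_zeros:
  fixes P :: "'t \<Rightarrow> real poly" and w :: "'t \<Rightarrow> real"
  assumes "finite A" "A \<noteq> {}" "inj_on w A" "\<And>t. t \<in> A \<Longrightarrow> P t \<noteq> 0"
    and "finite Z" "\<And>x. x \<in> Z \<Longrightarrow> (\<Sum>t\<in>A. poly (P t) x * exp (w t * x)) = 0"
  shows "card Z < (\<Sum>t\<in>A. degree (P t) + 1)"
  using assms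
proof (induction "\<Sum>t\<in>A. degree (P t) + 1" arbitrary: A P w Z rule: less_induct)
  case less
  then obtain t0 where t0: "t0 \<in> A" by blast
  \<comment> \<open>\<open>G\<close> is the function divided by \<open>exp (w t0 * x)\<close>; its derivative \<open>G'\<close> has coefficient polynomials \<open>Q t\<close>
    of unchanged degree, except that \<open>Q t0 = pderiv (P t0)\<close>\<close>
  define w' where "w' t = w t - w t0" for t
  define Q where "Q t = pderiv (P t) + Polynomial.smult (w' t) (P t)" for t
  define G where "G x = (\<Sum>t\<in>A. poly (P t) x * exp (w' t * x))" for x
  define G' where "G' x = (\<Sum>t\<in>A. poly (Q t) x * exp (w' t * x))" for x
  have [simp]: "w' t0 = 0" by (simp add: w'_def)
  have w'0: "w' t \<noteq> 0" if "t \<in> A" "t \<noteq> t0" for t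
    using that t0 \<open>inj_on w A\<close> by (auto simp: w'_def inj_on_def)
  have G_eq: "G x = exp (- (w t0 * x)) * (\<Sum>t\<in>A. poly (P t) x * exp (w t * x))" for x
    by (simp add: G_def w'_def sum_distrib_left left_diff_distrib exp_diff exp_minus field_simps)
  have G0: "G x = 0" if "x \<in> Z" for x using less.prems(6)[OF that] by (simp add: G_eq)
  have "(G has_real_derivative G' x) (at x)" for x
    unfolding G_def G'_def Q_def
    by (auto intro!: derivative_eq_intros sum.cong simp: algebra_simps)
  then obtain Z' where Z': "finite Z'" "card Z \<le> card Z' + 1" "\<And>z. z \<in> Z' \<Longrightarrow> G' z = 0"
    using rolle_card[of G G' Z] \<open>finite Z\<close> G0 by blast
  have degQ: "degree (Q t) = degree (P t) \<and> Q t \<noteq> 0" if "t \<in> A" "t \<noteq> t0" for t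
  proof -
    have "P t \<noteq> 0" using less.prems that by auto
    have "coeff (Q t) (degree (P t)) = w' t * coeff (P t) (degree (P t))"
      by (simp add: Q_def coeff_pderiv coeff_eq_0)
    hence *: "coeff (Q t) (degree (P t)) \<noteq> 0" using w'0[OF that] \<open>P t \<noteq> 0\<close> by simp
    have "degree (Q t) \<le> degree (P t)"
      unfolding Q_def by (intro degree_add_le) (auto simp: degree_pderiv)
    with * show ?thesis by (metis le_antisym le_degree coeff_0)
  qed
  have Qt0: "Q t0 = pderiv (P t0)" by (simp add: Q_def)
  have split: "(\<Sum>t\<in>A. degree (P t) + 1) = degree (P t0) + 1 + (\<Sum>t\<in>A-{t0}. degree (P t) + 1)"
    using less.prems t0 by (subst sum.remove[of A t0]) auto
  have sumQ: "(\<Sum>t\<in>A-{t0}. degree (Q t) + 1) = (\<Sum>t\<in>A-{t0}. degree (P t) + 1)"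
    using degQ by (intro sum.cong) auto
  have inj: "inj_on w' A" using \<open>inj_on w A\<close> by (auto simp: w'_def inj_on_def)
  show ?case
  proof (cases "degree (P t0) = 0")
    case False
    have Q0: "Q t \<noteq> 0" if "t \<in> A" for t
      using degQ[OF that] False by (cases "t = t0") (auto simp: Qt0 pderiv_eq_0_iff)
    have "(\<Sum>t\<in>A. degree (Q t) + 1) = degree (P t0) + (\<Sum>t\<in>A-{t0}. degree (P t) + 1)"
      using less.prems t0 False unfolding sumQ[symmetric]
      by (subst sum.remove[of A t0]) (auto simp: Qt0 degree_pderiv)
    hence lt: "(\<Sum>t\<in>A. degree (Q t) + 1) + 1 = (\<Sum>t\<in>A. degree (P t) + 1)"
      using split by simp
    have "card Z' < (\<Sum>t\<in>A. degree (Q t) + 1)"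
    proof (rule less.hyps[of _ _ w'])
      show "(\<Sum>t\<in>A. degree (Q t) + 1) < (\<Sum>t\<in>A. degree (P t) + 1)"
        using lt by linarith
      show "(\<Sum>t\<in>A. poly (Q t) x * exp (w' t * x)) = 0" if "x \<in> Z'" for x
        using Z'(3)[OF that] by (simp only: G'_def)
    qed (use Z'(1) Q0 inj less.prems(1,2) in auto)
    thus ?thesis using lt Z'(2) by linarith
  next
    case True
    hence Qz: "Q t0 = 0" by (simp add: Qt0 pderiv_eq_0_iff)
    show ?thesis
    proof (cases "A = {t0}")
      case True
      from \<open>degree (P t0) = 0\<close> obtain c where c: "P t0 = [:c:]" by (rule degree_eq_zeroE)
      with less.prems t0 have "c \<noteq> 0" by auto
      hence "G x \<noteq> 0" for x by (simp add: G_def True c)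
      hence "Z = {}" using G0 by auto
      thus ?thesis using True by simp
    next
      case False
      hence ne: "A - {t0} \<noteq> {}" using t0 by blast
      have "card Z' < (\<Sum>t\<in>A-{t0}. degree (Q t) + 1)"
      proof (rule less.hyps[of _ _ w'])
        show "(\<Sum>t\<in>A-{t0}. degree (Q t) + 1) < (\<Sum>t\<in>A. degree (P t) + 1)"
          by (simp only: sumQ split)
        show "inj_on w' (A - {t0})" using inj by (rule inj_on_subset) auto
        show "(\<Sum>t\<in>A-{t0}. poly (Q t) x * exp (w' t * x)) = 0" if "x \<in> Z'" for x
          using Z'(3)[OF that] less.prems t0 unfolding G'_def
          by (subst (asm) sum.remove[of A t0]) (auto simp: Qz)
      qed (use ne degQ less.prems Z' in auto)
      thus ?thesis using Z'(2) unfolding sumQ split by linarith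
    qed
  qed
qed

lemma exponential_monomials_zeros:
  fixes p :: "nat \<times> nat \<Rightarrow> real" and l :: real
  assumes l: "l \<noteq> 0" and p: "\<exists>u\<in>{..<T0} \<times> {..<T1}. p u \<noteq> 0"
    and Z: "finite Z"
      "\<And>x. x \<in> Z \<Longrightarrow> (\<Sum>u\<in>{..<T0} \<times> {..<T1}. p u * (x ^ fst u * exp (l * real (snd u) * x))) = 0"
  shows "card Z < T0 * T1"
proof -
  define P where "P t = (\<Sum>i<T0. monom (p (i, t)) i)" for t
  define A where "A = {t. t < T1 \<and> P t \<noteq> 0}"
  have coeff_P: "coeff (P t) i = (if i < T0 then p (i, t) else 0)" for t i
    by (simp add: P_def coeff_sum)
  have poly_P: "poly (P t) x = (\<Sum>i<T0. p (i, t) * x ^ i)" for t x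
    by (simp add: P_def poly_sum poly_monom)
  from p obtain i t where it: "i < T0" "t < T1" "p (i, t) \<noteq> 0" by auto
  hence "coeff (P t) i \<noteq> 0" by (simp add: coeff_P)
  hence "P t \<noteq> 0" by auto
  hence "A \<noteq> {}" using it by (auto simp: A_def)
  have "card Z < (\<Sum>t\<in>A. degree (P t) + 1)"
  proof (rule exponential_polynomial_zeros[of A "\<lambda>t. l * real t"])
    show "inj_on (\<lambda>t. l * real t) A" using l by (auto simp: inj_on_def)
    show "(\<Sum>t\<in>A. poly (P t) x * exp (l * real t * x)) = 0" if "x \<in> Z" for x
    proof -
      have "(\<Sum>t\<in>A. poly (P t) x * exp (l * real t * x)) = (\<Sum>t<T1. poly (P t) x * exp (l * real t * x))"
        by (intro sum.mono_neutral_left) (auto simp: A_def)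
      also have "\<dots> = (\<Sum>t<T1. \<Sum>i<T0. p (i, t) * (x ^ i * exp (l * real t * x)))"
        by (simp add: poly_P sum_distrib_right mult.assoc)
      also have "\<dots> = (\<Sum>i<T0. \<Sum>t<T1. p (i, t) * (x ^ i * exp (l * real t * x)))"
        by (rule sum.swap)
      also have "\<dots> = (\<Sum>u\<in>{..<T0} \<times> {..<T1}. p u * (x ^ fst u * exp (l * real (snd u) * x)))"
        by (simp add: sum.cartesian_product case_prod_unfold)
      finally show ?thesis using Z(2)[OF that] by simp
    qed
  qed (use \<open>A \<noteq> {}\<close> Z(1) in \<open>auto simp: A_def\<close>)
  also have "\<dots> \<le> (\<Sum>t\<in>A. T0)"
  proof (intro sum_mono)
    fix t
    have "degree (P t) \<le> T0 - 1" by (rule degree_le) (auto simp: coeff_P)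
    thus "degree (P t) + 1 \<le> T0" using it by simp
  qed
  also have "\<dots> = T0 * card A" by simp
  also have "\<dots> \<le> T0 * T1"
    using card_mono[of "{..<T1}" A] by (intro mult_left_mono) (auto simp: A_def)
  finally show ?thesis .
qed

section \<open>Entire functions with many zeros\<close>

lemma entire_factor_zeros:
  fixes f :: "complex \<Rightarrow> complex"
  assumes "finite Z" "f holomorphic_on UNIV" "\<And>z. z \<in> Z \<Longrightarrow> f z = 0"
  shows "\<exists>g. g holomorphic_on UNIV \<and> (\<forall>z. f z = g z * (\<Prod>a\<in>Z. z - a))"
  using assms
proof (induction Z rule: finite_induct)
  case empty
  thus ?case by auto
next
  case (insert a Z)
  then obtain g where g: "g holomorphic_on UNIV" "\<And>z. f z = g z * (\<Prod>a\<in>Z. z - a)" by auto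
  have "g a = 0"
    using g(2)[of a] insert by auto
  define h where "h z = (if z = a then deriv g a else g z / (z - a))" for z
  have "h holomorphic_on UNIV"
    by (rule pole_theorem_open_0[OF g(1), of a]) (auto simp: h_def \<open>g a = 0\<close>)
  moreover have "g z = h z * (z - a)" for z
    using \<open>g a = 0\<close> by (simp add: h_def)
  ultimately show ?case
    using insert.hyps g(2) by (intro exI[of _ h]) (auto simp: mult_ac)
qed

text \<open>
  Schwarz's lemma for many zeros: on the circle of radius \<open>5 r\<close> each factor \<open>z - a\<close> has modulus at least
  \<open>4 r\<close>, and in the disc of radius \<open>r\<close> at most \<open>2 r\<close>, so each zero in the disc gains a factor 2.
\<close>

lemma schwarz_many_zeros:
  fixes f :: "complex \<Rightarrow> complex"
  assumes Z: "finite Z" "Z \<subseteq> cball 0 r" "\<And>z. z \<in> Z \<Longrightarrow> f z = 0"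
    and f: "f holomorphic_on UNIV" "\<And>z. norm z = 5 * r \<Longrightarrow> norm (f z) \<le> B"
    and r: "r > 0" and x: "norm x \<le> r"
  shows "norm (f x) \<le> B / 2 ^ card Z"
proof -
  obtain g where g: "g holomorphic_on UNIV" "\<And>z. f z = g z * (\<Prod>a\<in>Z. z - a)"
    using entire_factor_zeros[OF Z(1) f(1) Z(3)] by blast
  have "norm (g x) \<le> B / (4 * r) ^ card Z"
  proof (rule maximum_modulus_frontier[of g "cball 0 (5 * r)"])
    show "g holomorphic_on interior (cball 0 (5 * r))"
      using g(1) by (rule holomorphic_on_subset) auto
    show "continuous_on (closure (cball 0 (5 * r))) g"
      using g(1) by (intro holomorphic_on_imp_continuous_on holomorphic_on_subset[OF g(1)]) auto
    show "x \<in> cball 0 (5 * r)" using x r by auto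
    show "norm (g z) \<le> B / (4 * r) ^ card Z" if "z \<in> frontier (cball 0 (5 * r))" for z
    proof -
      have z: "norm z = 5 * r" using that r by (simp add: frontier_cball)
      have "(4 * r) ^ card Z = (\<Prod>a\<in>Z. 4 * r)" by simp
      also have "\<dots> \<le> (\<Prod>a\<in>Z. norm (z - a))"
      proof (rule prod_mono, safe)
        fix a assume "a \<in> Z"
        hence "norm a \<le> r" using Z(2) by auto
        thus "4 * r \<le> norm (z - a)" using norm_triangle_ineq2[of z a] z by linarith
      qed (use r in auto)
      finally have "norm (g z) * (4 * r) ^ card Z \<le> norm (f z)"
        unfolding g(2) norm_mult prod_norm[symmetric] by (intro mult_left_mono) auto
      also have "\<dots> \<le> B" using f(2) z by blast
      finally show ?thesis using r by (simp add: field_simps)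
    qed
  qed auto
  moreover have "(\<Prod>a\<in>Z. norm (x - a)) \<le> (\<Prod>a\<in>Z. 2 * r)"
  proof (rule prod_mono, safe)
    fix a assume "a \<in> Z"
    hence "norm a \<le> r" using Z(2) by auto
    thus "norm (x - a) \<le> 2 * r" using norm_triangle_ineq4[of x a] x by linarith
  qed auto
  hence "norm (\<Prod>a\<in>Z. x - a) \<le> (2 * r) ^ card Z" by (simp add: prod_norm[symmetric])
  ultimately have "norm (f x) \<le> B / (4 * r) ^ card Z * (2 * r) ^ card Z"
    unfolding g(2) norm_mult by (intro mult_mono) (auto intro: order_trans[OF norm_ge_zero])
  also have "(4 * r) ^ card Z = 2 ^ card Z * (2 * r) ^ card Z"
    by (subst power_mult_distrib[symmetric]) simp
  also have "B / (2 ^ card Z * (2 * r) ^ card Z) * (2 * r) ^ card Z = B / 2 ^ card Z"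
  proof -
    have "B / (c * d) * d = B / c" if "d > 0" for c d :: real using that by simp
    thus ?thesis using r by simp
  qed
  finally show ?thesis .
qed

section \<open>The Gelfond-Schneider theorem over the reals\<close>

text \<open>
  Multiplication by one fixed power of the common denominator \<open>D\<close> clears the denominators of all
  monomials at once. The exponent \<open>T + 2 * K\<close> does not depend on \<open>\<tau>\<close>, \<open>a\<close> and \<open>b\<close>, so that integer
  combinations of the monomials are covered as well.
\<close>

lemma acts_monomial:
  assumes I: "finite I" and D: "D \<le> h" "h > 0"
    and acts: "acts I e h (of_nat D * \<alpha>)" "acts I e h (of_nat D * \<beta>)" "acts I e h (of_nat D * \<gamma>)"
    and le: "\<tau> \<le> T" "a \<le> K" "b \<le> K" "s1 \<le> S" "s2 \<le> S" "S > 0"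
  shows "acts I e ((2 * S) ^ T * h ^ (T + 2 * K))
    (of_nat D ^ (T + 2 * K) * ((of_nat s1 + of_nat s2 * \<beta>) ^ \<tau> * (\<alpha> ^ a * \<gamma> ^ b)))"
proof -
  have D': "acts I e h (of_nat D)"
    using acts_mono[OF acts_of_nat[OF I] D(1)] .
  have "acts I e (s1 * h + s2 * h) (of_nat s1 * of_nat D + of_nat s2 * (of_nat D * \<beta>))"
    by (intro acts_add acts_mult acts_of_nat I D' acts)
  moreover have "s1 * h + s2 * h \<le> 2 * S * h"
    using le unfolding distrib_right[symmetric] by (intro mult_right_mono) auto
  ultimately have lin: "acts I e (2 * S * h) (of_nat D * (of_nat s1 + of_nat s2 * \<beta>))"
    using acts_mono by (simp add: algebra_simps) blast
  have act: "acts I e (h ^ (T - \<tau>) * (2 * S * h) ^ \<tau> * ((h ^ a * h ^ (K - a)) * (h ^ b * h ^ (K - b))))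
    (of_nat D ^ (T - \<tau>) * (of_nat D * (of_nat s1 + of_nat s2 * \<beta>)) ^ \<tau> *
      (((of_nat D * \<alpha>) ^ a * of_nat D ^ (K - a)) * ((of_nat D * \<gamma>) ^ b * of_nat D ^ (K - b))))"
    by (intro acts_mult acts_power I D' acts lin)
  have eq: "of_nat D ^ (T - \<tau>) * (of_nat D * (of_nat s1 + of_nat s2 * \<beta>)) ^ \<tau> *
      (((of_nat D * \<alpha>) ^ a * of_nat D ^ (K - a)) * ((of_nat D * \<gamma>) ^ b * of_nat D ^ (K - b)))
    = of_nat D ^ (T + 2 * K) * ((of_nat s1 + of_nat s2 * \<beta>) ^ \<tau> * (\<alpha> ^ a * \<gamma> ^ b))"
  proof -
    have "T + 2 * K = (T - \<tau>) + \<tau> + (a + (K - a)) + (b + (K - b))" using le by simp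
    hence "real D ^ (T + 2 * K) = real D ^ (T - \<tau>) * real D ^ \<tau> * (real D ^ a * real D ^ (K - a)) *
        (real D ^ b * real D ^ (K - b))"
      by (simp only: power_add)
    thus ?thesis by (simp add: power_mult_distrib mult_ac)
  qed
  have le_bound: "h ^ (T - \<tau>) * (2 * S * h) ^ \<tau> * ((h ^ a * h ^ (K - a)) * (h ^ b * h ^ (K - b)))
    \<le> (2 * S) ^ T * h ^ (T + 2 * K)"
  proof -
    have "T + 2 * K = (T - \<tau>) + \<tau> + (a + (K - a)) + (b + (K - b))" using le by simp
    hence "h ^ (T + 2 * K) = h ^ (T - \<tau>) * h ^ \<tau> * (h ^ a * h ^ (K - a)) *
        (h ^ b * h ^ (K - b))"
      by (simp only: power_add)
    hence "h ^ (T - \<tau>) * (2 * S * h) ^ \<tau> * ((h ^ a * h ^ (K - a)) * (h ^ b * h ^ (K - b)))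
        = (2 * S) ^ \<tau> * h ^ (T + 2 * K)"
      by (simp add: power_mult_distrib mult_ac)
    also have "\<dots> \<le> (2 * S) ^ T * h ^ (T + 2 * K)"
      using le by (intro mult_right_mono power_increasing) auto
    finally show ?thesis .
  qed
  show ?thesis using acts_mono[OF act le_bound] unfolding eq .
qed

text \<open>
  The heart of the argument. Suppose that \<open>exp l\<close>, \<open>\<beta>\<close> and \<open>exp (l * \<beta>)\<close> are algebraic with common denominator
  \<open>D\<close>, realised by matrices of size \<open>n\<close>. Siegel's lemma gives an auxiliary function
  \<open>F x = (\<Sum>i<T. \<Sum>t<N. p i t * x ^ i * exp (l * t * x))\<close> with small integers \<open>p i t\<close> that vanishes at the \<open>N ^ 4\<close> points
  \<open>s1 + s2 * \<beta>\<close> with \<open>s1, s2 < N ^ 2\<close>: this is a system of \<open>n * N ^ 4\<close> integer equations in \<open>T * N = 2 * n * N ^ 4\<close>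
  unknowns. The number of zeros of \<open>F\<close> is less than \<open>T * N\<close>, so \<open>F\<close> does not vanish at
  some point \<open>s1 + s2 * \<beta>\<close> with \<open>s1, s2 < S\<close>. Schwarz's lemma bounds this value from above and Liouville's inequality
  bounds it from below; the inequality stated here is what the two bounds give together.
\<close>

lemma gelfond_schneider_inequality:
  fixes I :: "'i set" and l \<beta> :: real and D h N :: nat
  assumes I: "finite I" "i0 \<in> I" "e i0 \<noteq> 0"
    and D: "D > 0" "D \<le> h"
    and acts: "acts I e h (of_nat D * exp l)" "acts I e h (of_nat D * \<beta>)" "acts I e h (of_nat D * exp (l * \<beta>))"
    and l: "l \<noteq> 0" and \<beta>: "\<beta> \<notin> \<rat>" and N: "N > 0"
  defines "n \<equiv> card I"
  defines "T \<equiv> 2 * n * N ^ 3" and "S \<equiv> 2 * n * N ^ 2"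
  defines "A \<equiv> (2 * S) ^ T * h ^ (T + 2 * (N * S))"
  defines "R \<equiv> 2 * (T * N) ^ 2 * A ^ 2"
  defines "r \<equiv> real S * (1 + \<bar>\<beta>\<bar>)"
  shows "2 ^ (N ^ 4) \<le> real R ^ (n + 2) * ((5 * r) ^ T * exp (5 * \<bar>l\<bar> * real N * r))"
proof -
  define U where "U = {..<T} \<times> {..<N}"
  define Q where "Q = {..<N ^ 2} \<times> {..<N ^ 2}"
  define Q' where "Q' = {..<S} \<times> {..<S}"
  define L where "L = T * N"
  define E where "E = T + 2 * (N * S)"
  define pt where "pt s = real (fst s) + real (snd s) * \<beta>" for s :: "nat \<times> nat"
  define f where "f u x = x ^ fst u * exp (l * real (snd u) * x)" for u :: "nat \<times> nat" and x :: real
  define y where "y u s = real D ^ E * f u (pt s)" for u s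
  have n: "n > 0" unfolding n_def using I by (auto simp: card_gt_0_iff)
  have h: "h > 0" using D by linarith
  have S: "S > 0" using n N by (simp add: S_def)
  have Lpos: "L > 0" using n N by (simp add: L_def T_def)
  have Apos: "A > 0" using S h by (simp add: A_def)
  have finU: "finite U" and cardU: "card U = L" by (auto simp: U_def L_def card_cartesian_product)
  have N4: "N ^ 4 = N ^ 2 * N ^ 2" "N ^ 4 = N ^ 3 * N" by (simp_all add: eval_nat_numeral)
  have L_eq: "L = 2 * (n * N ^ 4)" by (simp add: L_def T_def N4(2) mult_ac)
  have QQ': "Q \<subseteq> Q'"
  proof -
    have "N ^ 2 \<le> S" using n by (simp add: S_def)
    thus ?thesis by (auto simp: Q_def Q'_def)
  qed
  have finQ: "finite Q" "finite Q'" by (auto simp: Q_def Q'_def)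
  have cardQ: "card Q = N ^ 4" by (simp add: Q_def card_cartesian_product N4(1) del: power_add_numeral power_add_numeral2)
  have cardQ': "L \<le> card Q'"
  proof -
    have "card Q' = L * (2 * n)"
      by (simp add: Q'_def card_cartesian_product S_def L_eq eval_nat_numeral algebra_simps)
    thus ?thesis using n by simp
  qed

  \<comment> \<open>the value of each monomial at each point of the large grid, with cleared denominators, is realised on \<open>e\<close>\<close>
  have acts_y: "acts I e A (y u s)" if uU: "u \<in> U" and sQ: "s \<in> Q'" for u s
  proof -
    obtain \<tau> t where u: "u = (\<tau>, t)" "\<tau> < T" "t < N" using uU by (auto simp: U_def)
    obtain s1 s2 where s: "s = (s1, s2)" "s1 < S" "s2 < S" using sQ by (auto simp: Q'_def)
    have "exp (l * real t * (real s1 + real s2 * \<beta>)) = exp l ^ (t * s1) * exp (l * \<beta>) ^ (t * s2)"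
      by (simp add: exp_of_nat_mult[symmetric] exp_add[symmetric] algebra_simps)
    moreover have "t * s1 \<le> N * S" "t * s2 \<le> N * S"
      using u s by (auto intro!: mult_le_mono)
    hence "acts I e A (real D ^ E *
        ((real s1 + real s2 * \<beta>) ^ \<tau> * (exp l ^ (t * s1) * exp (l * \<beta>) ^ (t * s2))))"
      unfolding A_def E_def using u s S
      by (intro acts_monomial[OF I(1) D(2) h acts]) auto
    ultimately show ?thesis by (simp add: y_def f_def pt_def u s)
  qed
  have "\<forall>x\<in>U \<times> Q'. \<exists>M :: 'i \<Rightarrow> 'i \<Rightarrow> int. \<forall>i\<in>I.
      (\<Sum>j\<in>I. of_int (M i j) * e j) = y (fst x) (snd x) * e i \<and> (\<Sum>j\<in>I. \<bar>M i j\<bar>) \<le> int A"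
    using acts_y unfolding acts_def by auto
  then obtain M' where M': "\<forall>x\<in>U \<times> Q'. \<forall>i\<in>I.
      (\<Sum>j\<in>I. of_int (M' x i j) * e j) = y (fst x) (snd x) * e i \<and> (\<Sum>j\<in>I. \<bar>M' x i j :: int\<bar>) \<le> int A"
    by (rule bchoice[THEN exE])
  define M where "M u s = M' (u, s)" for u s
  have M: "(\<Sum>j\<in>I. of_int (M u s i j) * e j) = y u s * e i" "(\<Sum>j\<in>I. \<bar>M u s i j\<bar>) \<le> int A"
    if "u \<in> U" "s \<in> Q'" "i \<in> I" for u s i
    using M' that by (auto simp: M_def)

  \<comment> \<open>only row \<open>i0\<close> of the matrices has to cancel, because \<open>e i0\<close> is nonzero\<close>
  obtain p where p: "\<exists>u\<in>U. p u \<noteq> 0" "\<And>u. u \<in> U \<Longrightarrow> \<bar>p u\<bar> \<le> 2 * int L * int A"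
    and p0: "\<And>v. v \<in> Q \<times> I \<Longrightarrow> (\<Sum>u\<in>U. p u * M u (fst v) i0 (snd v)) = 0"
  proof (rule siegel_pigeonhole[of U "Q \<times> I" A "\<lambda>u v. M u (fst v) i0 (snd v)"])
    show "card U = 2 * card (Q \<times> I)" "0 < card (Q \<times> I)"
      using n N by (auto simp: card_cartesian_product cardU L_eq cardQ n_def)
    show "\<bar>M u (fst v) i0 (snd v)\<bar> \<le> int A" if "u \<in> U" "v \<in> Q \<times> I" for u v
    proof -
      have "\<bar>M u (fst v) i0 (snd v)\<bar> \<le> (\<Sum>j\<in>I. \<bar>M u (fst v) i0 j\<bar>)"
        using that I by (intro member_le_sum) auto
      also have "\<dots> \<le> int A" using that QQ' I by (intro M(2)) auto
      finally show ?thesis .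
    qed
  qed (use finU finQ I Apos cardU in auto)

  define F where "F x = (\<Sum>u\<in>U. of_int (p u) * f u x)" for x
  have F_y: "real D ^ E * F (pt s) = (\<Sum>u\<in>U. of_int (p u) * y u s)" for s
    by (simp add: F_def y_def sum_distrib_left mult_ac)
  have F_zero: "F (pt s) = 0" if s: "s \<in> Q" for s
  proof -
    have "(real D ^ E * F (pt s)) * e i0 = (\<Sum>u\<in>U. of_int (p u) * (y u s * e i0))"
      unfolding F_y by (simp add: sum_distrib_right mult.assoc)
    also have "\<dots> = (\<Sum>u\<in>U. of_int (p u) * (\<Sum>j\<in>I. of_int (M u s i0 j) * e j))"
      using s QQ' I by (intro sum.cong refl arg_cong2[where f = "(*)"] M(1)[symmetric]) auto
    also have "\<dots> = (\<Sum>u\<in>U. \<Sum>j\<in>I. of_int (p u * M u s i0 j) * e j)"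
      by (simp add: sum_distrib_left mult.assoc)
    also have "\<dots> = (\<Sum>j\<in>I. of_int (\<Sum>u\<in>U. p u * M u s i0 j) * e j)"
      by (subst sum.swap) (simp add: sum_distrib_right)
    also have "\<dots> = 0"
      using p0[of "(s, j)" for j] s by (intro sum.neutral ballI) auto
    finally show ?thesis using I D by simp
  qed

  \<comment> \<open>this is where irrationality of \<open>\<beta>\<close> is used\<close>
  have inj: "inj pt"
  proof (rule injI)
    fix s s' assume eq: "pt s = pt s'"
    have "snd s = snd s'"
    proof (rule ccontr)
      assume ne: "snd s \<noteq> snd s'"
      have "(real (snd s) - real (snd s')) * \<beta> = real (fst s') - real (fst s)"
        using eq by (simp add: pt_def algebra_simps)
      hence "\<beta> = (real (fst s') - real (fst s)) / (real (snd s) - real (snd s'))"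
        using ne by (simp add: field_simps)
      also have "\<dots> \<in> \<rat>" by (intro Rats_divide Rats_diff) auto
      finally show False using \<beta> by blast
    qed
    thus "s = s'" using eq by (simp add: pt_def prod_eq_iff)
  qed

  \<comment> \<open>the large grid has at least \<open>T * N\<close> points, more than \<open>F\<close> has zeros\<close>
  obtain s where s: "s \<in> Q'" "F (pt s) \<noteq> 0"
  proof (rule ccontr)
    assume "\<not> thesis"
    hence *: "\<And>s. s \<in> Q' \<Longrightarrow> F (pt s) = 0" using that by blast
    have "card (pt ` Q') < T * N"
      by (rule exponential_monomials_zeros[OF l, of T N "\<lambda>u. of_int (p u)"])
         (use p(1) * finQ in \<open>auto simp: U_def F_def f_def\<close>)
    moreover have "card (pt ` Q') = card Q'"
      using inj by (intro card_image) (auto intro: inj_on_subset)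
    ultimately show False using cardQ' by (simp add: L_def)
  qed

  define X where "X = (5 * r) ^ T * exp (5 * \<bar>l\<bar> * real N * r)"
  have r1: "r \<ge> 1"
  proof -
    have "1 * 1 \<le> real S * (1 + \<bar>\<beta>\<bar>)" using S by (intro mult_mono) auto
    thus ?thesis by (simp add: r_def)
  qed
  have X_nonneg: "X \<ge> 0" using r1 by (simp add: X_def)
  have pt_le: "\<bar>pt s\<bar> \<le> r" if "s \<in> Q'" for s
  proof -
    have "\<bar>pt s\<bar> \<le> real (fst s) + real (snd s) * \<bar>\<beta>\<bar>"
      unfolding pt_def by (rule order_trans[OF abs_triangle_ineq]) (simp add: abs_mult)
    also have "\<dots> \<le> real S + real S * \<bar>\<beta>\<bar>"
      using that by (intro add_mono mult_right_mono) (auto simp: Q'_def)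
    finally show ?thesis by (simp add: r_def algebra_simps)
  qed

  \<comment> \<open>\<open>G\<close> is the entire extension of \<open>F\<close>\<close>
  define G where "G z = (\<Sum>u\<in>U. of_int (p u) * (z ^ fst u * exp (of_real (l * real (snd u)) * z)))" for z :: complex
  have G_real: "G (of_real x) = of_real (F x)" for x
    by (simp add: G_def F_def f_def exp_of_real[symmetric])
  have upper: "\<bar>F (pt s)\<bar> \<le> real R * X / 2 ^ (N ^ 4)"
  proof -
    have "norm (G (of_real (pt s))) \<le> real R * X / 2 ^ card ((\<lambda>s. complex_of_real (pt s)) ` Q)"
    proof (rule schwarz_many_zeros[where f = G and r = r])
      show "(\<lambda>s. complex_of_real (pt s)) ` Q \<subseteq> cball 0 r"
        using pt_le QQ' by auto
      show "G z = 0" if "z \<in> (\<lambda>s. complex_of_real (pt s)) ` Q" for z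
        using that F_zero by (auto simp: G_real)
      show "G holomorphic_on UNIV"
        unfolding G_def by (intro holomorphic_intros)
      show "norm (complex_of_real (pt s)) \<le> r" using pt_le s by simp
      show "norm (G z) \<le> real R * X" if z: "norm z = 5 * r" for z
      proof -
        have "norm (G z) \<le> (\<Sum>u\<in>U. (2 * real L * real A) * X)"
          unfolding G_def
        proof (rule sum_norm_le)
          fix u assume u: "u \<in> U"
          have "\<bar>p u\<bar> \<le> 2 * int L * int A" using p(2) u .
          hence "real_of_int \<bar>p u\<bar> \<le> real_of_int (2 * int L * int A)" by (rule of_int_le_iff[THEN iffD2])
          hence 1: "norm (of_int (p u) :: complex) \<le> 2 * real L * real A" by simp
          have "norm z ^ fst u \<le> norm z ^ T"
            using u r1 z by (intro power_increasing) (auto simp: U_def)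
          hence 2: "norm (z ^ fst u) \<le> (5 * r) ^ T" by (simp add: norm_power z)
          have "norm (exp (of_real (l * real (snd u)) * z)) \<le> exp (norm (of_real (l * real (snd u)) * z))"
            by (rule norm_exp)
          also have "norm (of_real (l * real (snd u)) * z) = 5 * \<bar>l\<bar> * real (snd u) * r"
            using r1 by (simp add: norm_mult z abs_mult)
          also have "\<dots> \<le> 5 * \<bar>l\<bar> * real N * r"
            using u r1 by (intro mult_right_mono mult_left_mono) (auto simp: U_def)
          finally have 3: "norm (exp (of_real (l * real (snd u)) * z)) \<le> exp (5 * \<bar>l\<bar> * real N * r)"
            by simp
          show "norm (of_int (p u) * (z ^ fst u * exp (of_real (l * real (snd u)) * z))) \<le> 2 * real L * real A * X"
            unfolding X_def norm_mult[of "of_int (p u)"] norm_mult[of "z ^ fst u"]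
            using r1 by (intro mult_mono 1 2 3) auto
        qed
        also have "\<dots> = real (2 * L ^ 2 * A) * X"
          by (simp add: cardU power2_eq_square)
        also have "\<dots> \<le> real R * X"
        proof (intro mult_right_mono X_nonneg of_nat_mono)
          show "2 * L ^ 2 * A \<le> R" using Apos by (simp add: R_def L_def power2_eq_square)
        qed
        finally show ?thesis .
      qed
    qed (use finQ r1 in auto)
    moreover have "card ((\<lambda>s. complex_of_real (pt s)) ` Q) = N ^ 4"
      unfolding cardQ[symmetric] using inj by (intro card_image) (auto simp: inj_on_def)
    ultimately show ?thesis by (simp add: G_real)
  qed

  have lower: "1 \<le> \<bar>real D ^ E * F (pt s)\<bar> * real R ^ n"
    unfolding n_def
  proof (rule acts_lower_bound[of I i0 e, OF I])
    have "acts I e (\<Sum>u\<in>U. nat \<bar>p u\<bar> * A) (real D ^ E * F (pt s))"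
      unfolding F_y using I s finU by (intro acts_sum acts_mult acts_of_int acts_y) auto
    moreover have "(\<Sum>u\<in>U. nat \<bar>p u\<bar> * A) \<le> R"
    proof -
      have "(\<Sum>u\<in>U. nat \<bar>p u\<bar> * A) \<le> (\<Sum>u\<in>U. (2 * L * A) * A)"
      proof (intro sum_mono mult_right_mono)
        fix u assume "u \<in> U"
        from p(2)[OF this] have "\<bar>p u\<bar> \<le> int (2 * L * A)" by simp
        thus "nat \<bar>p u\<bar> \<le> 2 * L * A" by linarith
      qed auto
      also have "\<dots> = R" by (simp add: cardU R_def L_def[symmetric] power2_eq_square)
      finally show ?thesis .
    qed
    ultimately show "acts I e R (real D ^ E * F (pt s))" by (rule acts_mono)
  qed (use s D in auto)

  have "D ^ E \<le> R"
  proof -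
    have "D ^ E \<le> h ^ E" using D by (intro power_mono) auto
    also have "\<dots> \<le> A" using S by (simp add: A_def E_def)
    also have "\<dots> \<le> 2 * L\<^sup>2 * A * A" using Lpos Apos by simp
    also have "\<dots> = R" by (simp add: R_def L_def power2_eq_square)
    finally show ?thesis .
  qed
  hence DR: "real D ^ E \<le> real R" by (metis of_nat_le_iff of_nat_power)
  have "1 \<le> \<bar>F (pt s)\<bar> * (real D ^ E * real R ^ n)"
    using lower by (simp add: abs_mult mult_ac)
  also have "\<dots> \<le> (real R * X / 2 ^ (N ^ 4)) * (real R * real R ^ n)"
    using DR upper X_nonneg by (intro mult_mono) auto
  also have "\<dots> = real R ^ (n + 2) * X / 2 ^ (N ^ 4)" by (simp add: power_add power2_eq_square)
  finally show ?thesis by (simp add: X_def field_simps)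
qed

text \<open>
  The left-hand side is the logarithm of the upper bound in the previous lemma, with \<open>x = N\<close>, \<open>b = 1 + \<bar>\<beta>\<bar>\<close>
  and \<open>c = \<bar>l\<bar>\<close>. It is of order \<open>x ^ 3 * ln x\<close>.
\<close>

lemma gelfond_schneider_asymptotics:
  fixes n h b c :: real
  assumes "n \<ge> 1" "h \<ge> 2" "b \<ge> 1" "c > 0"
  shows "eventually (\<lambda>x::nat. (n + 2) * (ln 2 + 2 * ln (2 * n * x ^ 4)
     + 2 * (2 * n * x ^ 3 * ln (4 * n * x ^ 2) + 6 * n * x ^ 3 * ln h))
     + (2 * n * x ^ 3 * ln (10 * n * x ^ 2 * b) + 10 * c * n * b * x ^ 3) < x ^ 4 * ln 2) at_top"
proof -
  have "n > 0" "h > 1" "b > 0" "ln h > 0" using assms by auto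
  thus ?thesis using assms by real_asymp
qed

text \<open>
  The theorem of Gelfond and Schneider for a positive real base and a real exponent.
\<close>

theorem gelfond_schneider_real:
  fixes \<alpha> \<beta> :: real
  assumes "\<alpha> > 0" "\<alpha> \<noteq> 1" "algebraic \<alpha>" "algebraic \<beta>" "\<beta> \<notin> \<rat>"
  shows "\<not> algebraic (\<alpha> powr \<beta>)"
proof
  assume alg: "algebraic (\<alpha> powr \<beta>)"
  define l where "l = ln \<alpha>"
  have l: "l \<noteq> 0" "exp l = \<alpha>" "exp (l * \<beta>) = \<alpha> powr \<beta>"
    using assms(1,2) by (auto simp: l_def powr_def mult.commute)
  obtain I :: "((nat \<times> nat) \<times> nat) set" and e i0 D h where I: "finite I" "i0 \<in> I" "e i0 \<noteq> 0"
    and D: "D > 0" "D \<le> h" "2 \<le> h"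
    and acts: "acts I e h (of_nat D * \<alpha>)" "acts I e h (of_nat D * \<beta>)" "acts I e h (of_nat D * \<alpha> powr \<beta>)"
    using algebraic_common_acts3[OF assms(3,4) alg] by metis
  define n where "n = card I"
  define b where "b = 1 + \<bar>\<beta>\<bar>"
  have n: "n > 0" unfolding n_def using I by (auto simp: card_gt_0_iff)
  have no: "\<not> ((real n + 2) * (ln 2 + 2 * ln (2 * real n * real N ^ 4)
     + 2 * (2 * real n * real N ^ 3 * ln (4 * real n * real N ^ 2) + 6 * real n * real N ^ 3 * ln (real h)))
     + (2 * real n * real N ^ 3 * ln (10 * real n * real N ^ 2 * b) + 10 * \<bar>l\<bar> * real n * b * real N ^ 3) < real N ^ 4 * ln 2)"
    if N: "N > 0" for N :: nat
  proof -
    define T where "T = 2 * n * N ^ 3"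
    define S where "S = 2 * n * N ^ 2"
    define A where "A = (2 * S) ^ T * h ^ (T + 2 * (N * S))"
    define R where "R = 2 * (T * N) ^ 2 * A ^ 2"
    define r where "r = real S * b"
    have "T > 0" "S > 0" using n N by (auto simp: T_def S_def)
    have "A > 0" using \<open>S > 0\<close> D by (simp add: A_def)
    hence "R > 0" using \<open>T > 0\<close> N by (simp add: R_def)
    have "b > 0" by (simp add: b_def)
    hence "r > 0" using \<open>S > 0\<close> by (simp add: r_def)
    have "2 ^ (N ^ 4) \<le> real R ^ (n + 2) * ((5 * r) ^ T * exp (5 * \<bar>l\<bar> * real N * r))"
      unfolding R_def A_def r_def T_def S_def n_def b_def
      by (rule gelfond_schneider_inequality[OF I D(1,2) _ acts(2) _ l(1) assms(5) N])
         (use acts l in auto)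
    hence "ln (2 ^ (N ^ 4)) \<le> ln (real R ^ (n + 2) * ((5 * r) ^ T * exp (5 * \<bar>l\<bar> * real N * r)))"
      by (rule ln_mono[rotated 2]) (use \<open>R > 0\<close> \<open>r > 0\<close> in auto)
    also have "\<dots> = (real n + 2) * ln R + (T * ln (5 * r) + 5 * \<bar>l\<bar> * N * r)"
      using \<open>R > 0\<close> \<open>r > 0\<close> by (simp add: ln_mult ln_realpow algebra_simps)
    also have "ln R = ln 2 + 2 * ln (T * N) + 2 * ln A"
      using \<open>A > 0\<close> \<open>T > 0\<close> N by (simp add: R_def ln_mult ln_realpow)
    also have "ln A = T * ln (2 * S) + (T + 2 * (N * S)) * ln h"
      using \<open>S > 0\<close> D by (simp add: A_def ln_mult ln_realpow distrib_left)
    finally have *: "ln (2 ^ (N ^ 4)) \<le> (real n + 2) * (ln 2 + 2 * ln (real (T * N)) +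
        2 * (real T * ln (real (2 * S)) + (real T + 2 * (real N * real S)) * ln (real h))) +
        (real T * ln (5 * r) + 5 * \<bar>l\<bar> * real N * r)"
      by simp
    have eqs: "ln (2 ^ (N ^ 4)) = real N ^ 4 * ln 2" "real (T * N) = 2 * real n * real N ^ 4"
      "real T + 2 * (real N * real S) = 6 * real n * real N ^ 3" "5 * r = 10 * real n * real N ^ 2 * b"
      "5 * \<bar>l\<bar> * N * r = 10 * \<bar>l\<bar> * real n * b * real N ^ 3" "real (2 * S) = 4 * real n * real N ^ 2"
      by (simp_all add: ln_realpow T_def r_def S_def eval_nat_numeral)
    have T: "real T = 2 * real n * real N ^ 3" by (simp add: T_def)
    show ?thesis unfolding not_less by (rule *[unfolded eqs, unfolded T])
  qed
  have ev: "eventually (\<lambda>N::nat. (real n + 2) * (ln 2 + 2 * ln (2 * real n * real N ^ 4)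
     + 2 * (2 * real n * real N ^ 3 * ln (4 * real n * real N ^ 2) + 6 * real n * real N ^ 3 * ln (real h)))
     + (2 * real n * real N ^ 3 * ln (10 * real n * real N ^ 2 * b) + 10 * \<bar>l\<bar> * real n * b * real N ^ 3) < real N ^ 4 * ln 2) at_top"
    by (rule gelfond_schneider_asymptotics) (use n D l in \<open>auto simp: b_def\<close>)
  show False
    using no eventually_happens'[OF sequentially_bot eventually_conj[OF eventually_gt_at_top[of 0] ev]]
    by blast
qed

section \<open>The Lambert-Tsallis function\<close>

theorem theorem3:
  fixes q z w :: real
  assumes "algebraic q"
    and "q \<notin> \<rat>"
    and "algebraic z"
    and "z \<noteq> 0"
    and "w \<in> lambert_tsallis q z"
  shows "transcendental w"
proof
  assume w: "algebraic w"
  have "q \<noteq> 1" using assms(2) by auto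
  have zw: "w * tsallis_exp q w = z" using assms(5) by (simp add: lambert_tsallis_def)
  define \<alpha> where "\<alpha> = 1 + (1 - q) * w"
  define \<beta> where "\<beta> = 1 / (1 - q)"
  have "w \<noteq> 0" "tsallis_exp q w \<noteq> 0" using zw assms(4) by auto
  have "\<alpha> > 0" and te: "tsallis_exp q w = \<alpha> powr \<beta>"
    using \<open>tsallis_exp q w \<noteq> 0\<close> \<open>q \<noteq> 1\<close>
    by (auto simp: tsallis_exp_def \<alpha>_def \<beta>_def split: if_splits simp: order_less_le)
  have "\<alpha> \<noteq> 1" using \<open>w \<noteq> 0\<close> \<open>q \<noteq> 1\<close> by (simp add: \<alpha>_def)
  have q1: "algebraic (1 - q)"
    using algebraic_add[OF algebraic_1 algebraic_minus[OF assms(1)]] by simp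
  have "algebraic \<alpha>" unfolding \<alpha>_def by (intro algebraic_add algebraic_mult algebraic_1 q1 w)
  moreover have "algebraic \<beta>"
    unfolding \<beta>_def using algebraic_inverse[OF q1] by (simp add: inverse_eq_divide)
  moreover have "\<beta> \<notin> \<rat>"
  proof
    assume "\<beta> \<in> \<rat>"
    hence "1 - 1 / \<beta> \<in> \<rat>" by (intro Rats_diff Rats_divide) auto
    thus False using assms(2) by (simp add: \<beta>_def)
  qed
  moreover have "algebraic (\<alpha> powr \<beta>)"
  proof -
    have "\<alpha> powr \<beta> = z * inverse w" using zw te \<open>w \<noteq> 0\<close> by (simp add: field_simps)
    thus ?thesis using algebraic_mult[OF assms(3) algebraic_inverse[OF w]] by simp
  qed
  ultimately show False
    using gelfond_schneider_real[OF \<open>\<alpha> > 0\<close> \<open>\<alpha> \<noteq> 1\<close>] by blast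
qed

end
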